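(* Let $G$ be a graph and let $P=(p_{ij})_{i,j\in V(G)}$ be a Markov chain on $G$, i.e. $$\sum_{j\in N(i)}p_{ij}=1\quad\text{for all } i\in V(G),$$ where $p_{ij}\geq 0$ and $p_{ij}=0$ if $(i,j)\notin E(G)$. Let $Q=(q_i)_{i\in V(G)}$ be the stationary distribution of $P$, i.e. a probability distribution on $V(G)$ with $$\sum_{j\in N(i)}q_jp_{ji}=q_i\quad\text{for all } i\in V(G).$$ Define the entropies $$H(Q)=\sum_{i\in V(G)}q_i\log \frac{1}{q_i},\qquad H(D|Q)=\sum_{i\in V(G)}q_i\log d_i,$$ $$H(P|Q)=\sum_{i\in V(G)}q_i\left(\sum_{j\in N(i)}p_{ij}\log\frac{1}{p_{ij}}\right),$$ where $d_i$ is the degree of the vertex $i$. Let $T_m$ be a tree with $\ell$ leaves on $m$ vertices, where $m\geq 3$. Then $$\hom(T_m,G)\geq \exp\bigl(H(Q)+\ell H(D|Q)+(m-1-\ell)H(P|Q)\bigr).$$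
   Context: Graphs are finite, undirected, without loops and multiple edges. $N(i)$ is the set of neighbors of the vertex $i$. $\hom(H,G)$ denotes the number of homomorphisms from $H$ to $G$, i.e. maps $f:V(H)\to V(G)$ such that images of adjacent vertices are adjacent. $\log$ is the natural logarithm, with the convention $0\log\frac{1}{0}=0$. *)

theory Defs
  imports Complex_Main "HOL-Library.FuncSet" "Graph_Theory.Graph_Theory"
begin

text \<open>
  Finite simple graphs are the \<^locale>\<open>pair_graph\<close>s of \<open>Graph_Theory\<close>, i.e. finite symmetric loopfree
  sets of ordered pairs: an undirected edge is represented by its two orientations. Hence
  \<^const>\<open>out_degree\<close> is the usual degree.
\<close>

definition nbrs :: "'a pair_pre_digraph \<Rightarrow> 'a \<Rightarrow> 'a set" where
  "nbrs G i = {j. (i, j) \<in> parcs G}"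

text \<open>
  The library's \<^const>\<open>tree\<close> cannot be used here: in a symmetric digraph every edge, walked back and
  forth, is a \<open>cycle\<close> of length 2. In a \<^locale>\<open>pair_graph\<close> the cycles in the sense of undirected
  graphs are exactly those of length at least 3. Connectedness includes being nonempty. The constant is
  qualified because of the topological notion of the same name.
\<close>

definition undirected_tree :: "'a pair_pre_digraph \<Rightarrow> bool" where
  "undirected_tree T \<longleftrightarrow>
     pair_graph T \<and> Digraph_Component.connected (with_proj T) \<and>
     \<not> (\<exists>p. pre_digraph.cycle (with_proj T) p \<and> 3 \<le> length p)"

definition leaves :: "'a pair_pre_digraph \<Rightarrow> 'a set" where
  "leaves T = {v \<in> pverts T. out_degree (with_proj T) v = 1}"

text \<open>
  Homomorphisms are taken to be \<open>undefined\<close> outside the vertices of \<open>H\<close>, so that each map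
  between the vertex sets is counted once.
\<close>

definition homs :: "'b pair_pre_digraph \<Rightarrow> 'a pair_pre_digraph \<Rightarrow> ('b \<Rightarrow> 'a) set" where
  "homs H G = {f \<in> pverts H \<rightarrow>\<^sub>E pverts G. \<forall>(u, v) \<in> parcs H. (f u, f v) \<in> parcs G}"

definition hom_count :: "'b pair_pre_digraph \<Rightarrow> 'a pair_pre_digraph \<Rightarrow> nat" where
  "hom_count H G = card (homs H G)"

definition markov_chain_on :: "'a pair_pre_digraph \<Rightarrow> ('a \<Rightarrow> 'a \<Rightarrow> real) \<Rightarrow> bool" where
  "markov_chain_on G p \<longleftrightarrow>
     (\<forall>i \<in> pverts G. \<forall>j \<in> pverts G. 0 \<le> p i j) \<and>
     (\<forall>i \<in> pverts G. \<forall>j \<in> pverts G. (i, j) \<notin> parcs G \<longrightarrow> p i j = 0) \<and>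
     (\<forall>i \<in> pverts G. (\<Sum>j \<in> nbrs G i. p i j) = 1)"

definition stationary_distribution ::
  "'a pair_pre_digraph \<Rightarrow> ('a \<Rightarrow> 'a \<Rightarrow> real) \<Rightarrow> ('a \<Rightarrow> real) \<Rightarrow> bool" where
  "stationary_distribution G p q \<longleftrightarrow>
     (\<forall>i \<in> pverts G. 0 \<le> q i) \<and>
     (\<Sum>i \<in> pverts G. q i) = 1 \<and>
     (\<forall>i \<in> pverts G. (\<Sum>j \<in> nbrs G i. q j * p j i) = q i)"

text \<open>
  In the entropies the convention \<open>0 log (1/0) = 0\<close> holds automatically, because of the factor 0.
\<close>

definition entropy_Q :: "'a pair_pre_digraph \<Rightarrow> ('a \<Rightarrow> real) \<Rightarrow> real" where
  "entropy_Q G q = (\<Sum>i \<in> pverts G. q i * ln (1 / q i))"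

definition entropy_D_given_Q :: "'a pair_pre_digraph \<Rightarrow> ('a \<Rightarrow> real) \<Rightarrow> real" where
  "entropy_D_given_Q G q = (\<Sum>i \<in> pverts G. q i * ln (real (out_degree (with_proj G) i)))"

definition entropy_P_given_Q ::
  "'a pair_pre_digraph \<Rightarrow> ('a \<Rightarrow> 'a \<Rightarrow> real) \<Rightarrow> ('a \<Rightarrow> real) \<Rightarrow> real" where
  "entropy_P_given_Q G p q = (\<Sum>i \<in> pverts G. q i * (\<Sum>j \<in> nbrs G i. p i j * ln (1 / p i j)))"

end

theory Submission
  imports Defs
begin

text \<open>
  The proof is an entropy argument. Root the tree \<open>T\<close> at a vertex \<open>r\<close> that is not a leaf and build a
  random homomorphism \<open>T \<rightarrow> G\<close> from the root outwards: the image of \<open>r\<close> has law \<open>q\<close>; once the image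
  \<open>i\<close> of the parent of \<open>v\<close> is chosen, the image of \<open>v\<close> is drawn from the transition probabilities
  \<open>p i\<close> if \<open>v\<close> is not a leaf, and uniformly from the neighbours of \<open>i\<close> if \<open>v\<close> is a leaf. Every parent is a
  non-leaf, so by stationarity its image has law \<open>q\<close>. By the chain rule for entropy, the root
  contributes \<open>H(Q)\<close>, each leaf contributes \<open>H(D|Q)\<close>, and each of the remaining \<open>m - 1 - l\<close> vertices
  contributes \<open>H(P|Q)\<close>. The entropy of a distribution on a finite set is at most the logarithm of the
  size of the set (\<open>entropy_le_ln_card\<close>), which here is the number of homomorphisms.

  Two facts carry the construction. \<open>undirected_tree_induct\<close> says that \<open>T\<close> arises from \<open>r\<close> by
  attaching one new vertex at a time, always to a vertex that is not a leaf of \<open>T\<close>.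
  \<open>add_pendant_distribution\<close> is the chain rule for one such attachment; the uniform choice and the
  chain \<open>p\<close> are two instances of the same transition kernel.
\<close>

section \<open>Trees grow by pendant vertices\<close>

definition single_vertex :: "'b \<Rightarrow> 'b pair_pre_digraph" where
  "single_vertex r = \<lparr>pverts = {r}, parcs = {}\<rparr>"

definition add_pendant :: "'b pair_pre_digraph \<Rightarrow> 'b \<Rightarrow> 'b \<Rightarrow> 'b pair_pre_digraph" where
  "add_pendant H u v = \<lparr>pverts = insert v (pverts H), parcs = parcs H \<union> {(u, v), (v, u)}\<rparr>"

lemma out_degree_eq_card_nbrs: "out_degree (with_proj G) i = card (nbrs G i)"
proof -
  have "out_arcs (with_proj G) i = Pair i ` nbrs G i"
    by (auto simp: out_arcs_def nbrs_def)
  then show ?thesis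
    by (simp add: out_degree_def card_image inj_on_def)
qed

context pair_graph
begin

lemma nbrs_subset: "nbrs G i \<subseteq> pverts G"
  by (auto simp: nbrs_def dest: in_arcsD2)

lemma finite_nbrs: "finite (nbrs G i)"
  using nbrs_subset pair_finite_verts by (rule finite_subset)

lemma not_leafI:
  assumes "(u, v) \<in> parcs G" "(u, w) \<in> parcs G" "v \<noteq> w"
  shows "u \<notin> leaves G"
proof -
  have "card {v, w} \<le> card (nbrs G u)"
    using assms finite_nbrs by (intro card_mono) (auto simp: nbrs_def)
  with assms show ?thesis
    by (simp add: leaves_def out_degree_eq_card_nbrs)
qed

text \<open>
  In a symmetric digraph connectedness gives directed reachability; on a walk from \<open>S\<close> to a vertex
  outside \<open>S\<close>, some arc leaves \<open>S\<close>.
\<close>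

lemma connected_leaving_arc:
  assumes "Digraph_Component.connected (with_proj G)"
    and "S \<subseteq> pverts G" "S \<noteq> {}" "S \<noteq> pverts G"
  obtains u v where "u \<in> S" "v \<notin> S" "(u, v) \<in> parcs G"
proof -
  obtain a b where ab: "a \<in> S" "b \<in> pverts G" "b \<notin> S"
    using assms by auto
  have "strongly_connected (with_proj G)"
    using assms(1) sym_arcs by (intro symmetric_connected_imp_strongly_connected) auto
  then have "a \<rightarrow>\<^sup>*\<^bsub>with_proj G\<^esub> b"
    using ab assms(2) by (auto simp: strongly_connected_def)
  then have "b \<notin> S \<longrightarrow> (\<exists>u v. u \<in> S \<and> v \<notin> S \<and> (u, v) \<in> parcs G)"
    by (induction rule: reachable_induct) (use ab in auto)
  with ab that show thesis by blast
qed

text \<open>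
  The ends \<open>a\<close>, \<open>b\<close> of an edge do not exhaust the graph, so one of them has a further neighbour.
\<close>

lemma connected_nonleaf_exists:
  assumes conn: "Digraph_Component.connected (with_proj G)" and card: "3 \<le> card (pverts G)"
  obtains r where "r \<in> pverts G" "r \<notin> leaves G"
proof -
  obtain a where a: "a \<in> pverts G"
    using card by fastforce
  have small: "S \<noteq> pverts G" if "card S \<le> 2" for S
    using card that by auto
  have "{a} \<noteq> pverts G"
    by (rule small) simp
  with a obtain b where b: "(a, b) \<in> parcs G" "b \<noteq> a"
    using connected_leaving_arc[OF conn, of "{a}"] by auto
  have "{a, b} \<noteq> pverts G"
    by (rule small) (simp add: card_insert_if)
  then obtain u v where uv: "u \<in> {a, b}" "v \<notin> {a, b}" "(u, v) \<in> parcs G"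
    using connected_leaving_arc[OF conn, of "{a, b}"] b in_arcsD1 in_arcsD2 by blast
  have "u \<notin> leaves G"
    using uv b arcs_symmetric[OF b(1)] not_leafI[of u v] by auto
  with uv that show thesis
    by (auto dest: in_arcsD1)
qed

text \<open>
  Connectedness of the subgraph induced on \<open>S\<close>, phrased with paths of the whole graph: a path between
  two neighbours of an outside vertex is what closes up to a cycle.
\<close>

definition apath_connected :: "'a set \<Rightarrow> bool" where
  "apath_connected S \<longleftrightarrow> (\<forall>x\<in>S. \<forall>y\<in>S. \<exists>p. apath x p y \<and> set (awalk_verts x p) \<subseteq> S)"

lemma apath_connected_singleton: "r \<in> pverts G \<Longrightarrow> apath_connected {r}"
  by (auto simp: apath_connected_def apath_Nil_iff intro!: exI[of _ "[]"])

lemma apath_connected_insert: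
  assumes S: "apath_connected S" and u: "u \<in> S" and v: "v \<notin> S" and uv: "(u, v) \<in> parcs G"
  shows "apath_connected (insert v S)"
  unfolding apath_connected_def
proof (intro ballI)
  have vu: "(v, u) \<in> parcs G"
    using uv by (rule arcs_symmetric)
  have out: "\<exists>p. apath v p y \<and> set (awalk_verts v p) \<subseteq> insert v S" if y: "y \<in> S" for y
  proof -
    obtain p where "apath u p y" "set (awalk_verts u p) \<subseteq> S"
      using S u y unfolding apath_connected_def by blast
    then have "apath v ((v, u) # p) y \<and> set (awalk_verts v ((v, u) # p)) \<subseteq> insert v S"
      using v vu by (auto simp: apath_Cons_iff)
    then show ?thesis ..
  qed
  fix x y assume xy: "x \<in> insert v S" "y \<in> insert v S"
  consider "x \<in> S" "y \<in> S" | "x = v" "y \<in> S" | "x \<in> S" "y = v" | "x = v" "y = v"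
    using xy by auto
  then show "\<exists>p. apath x p y \<and> set (awalk_verts x p) \<subseteq> insert v S"
  proof cases
    case 1
    then show ?thesis
      using S unfolding apath_connected_def by (meson subset_insertI subset_trans)
  next
    case 2
    then show ?thesis using out by simp
  next
    case 3
    then obtain p where p: "apath v p x" "set (awalk_verts v p) \<subseteq> insert v S"
      using out by blast
    then have "apath x (rev_path p) v" by simp
    moreover have "set (awalk_verts x (rev_path p)) \<subseteq> insert v S"
      using p awalk_verts_rev_path[of v p x] by (simp add: apath_def)
    ultimately show ?thesis using 3 by blast
  next
    case 4
    then show ?thesis
      using uv by (auto simp: apath_Nil_iff dest: in_arcsD2 intro!: exI[of _ "[]"])
  qed
qed

text \<open>
  A path in \<open>S\<close> from \<open>u\<close> to \<open>w\<close> has at least one arc, so the detour through \<open>v\<close> closes it to a cycle of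
  length at least 3. Hence in a tree an outside vertex attaches to a connected set by only one edge.
\<close>

lemma cycle_of_two_attachments:
  assumes S: "apath_connected S" and u: "u \<in> S" "w \<in> S" "u \<noteq> w" and v: "v \<notin> S"
    and uv: "(u, v) \<in> parcs G" and wv: "(w, v) \<in> parcs G"
  shows "\<exists>c. cycle c \<and> 3 \<le> length c"
proof -
  obtain p where p: "apath u p w" "set (awalk_verts u p) \<subseteq> S"
    using S u unfolding apath_connected_def by blast
  let ?c = "(v, u) # p @ [(w, v)]"
  have "p \<noteq> []"
    using p u by (auto simp: apath_Nil_iff)
  have walk: "awalk u p w"
    using p by (simp add: apath_def)
  have walk': "awalk u (p @ [(w, v)]) v"
    using walk wv by (auto simp: awalk_simps dest: in_arcsD2)
  then have "awalk v ?c v"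
    using arcs_symmetric[OF uv] by (auto simp: awalk_simps dest: in_arcsD1)
  moreover have "awalk_verts u (p @ [(w, v)]) = awalk_verts u p @ [v]"
    by (subst awalk_verts_append[OF walk']) simp
  then have "distinct (tl (awalk_verts v ?c))"
    using p v by (auto simp: apath_def)
  ultimately have "cycle ?c"
    by (auto simp: cycle_def)
  moreover have "3 \<le> length ?c"
    using \<open>p \<noteq> []\<close> by (cases p) auto
  ultimately show ?thesis by blast
qed

end

text \<open>
  The subtrees of the induction are those induced on connected sets \<open>S\<close> containing \<open>r\<close>. As long as \<open>S\<close>
  is not everything, an arc \<open>(u, v)\<close> leaves it, and by acyclicity \<open>u\<close> is the only neighbour of \<open>v\<close> in
  \<open>S\<close>. The leaves are those of the final tree \<open>T\<close>, not of the current subtree \<open>H\<close>: the vertex \<open>u\<close> is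
  not one, since besides \<open>v\<close> it has a neighbour in \<open>S\<close>, unless it is \<open>r\<close> itself.
\<close>

lemma undirected_tree_induct [consumes 3, case_names single pendant]:
  fixes T :: "'b pair_pre_digraph"
  assumes tree: "undirected_tree T" and r: "r \<in> pverts T" "r \<notin> leaves T"
    and single: "P (single_vertex r)"
    and pendant: "\<And>H u v. \<lbrakk>finite (pverts H); parcs H \<subseteq> pverts H \<times> pverts H; pverts H \<subseteq> pverts T;
      r \<in> pverts H; u \<in> pverts H; u \<notin> leaves T; v \<in> pverts T; v \<notin> pverts H; P H\<rbrakk>
      \<Longrightarrow> P (add_pendant H u v)"
  shows "P T"
proof -
  interpret T: pair_graph T
    using tree by (simp add: undirected_tree_def)
  define ind where "ind S = \<lparr>pverts = S, parcs = parcs T \<inter> S \<times> S\<rparr>" for S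
  have acyclic: "\<nexists>c. T.cycle c \<and> 3 \<le> length c"
    using tree by (simp add: undirected_tree_def)
  have conn: "Digraph_Component.connected (with_proj T)"
    using tree by (simp add: undirected_tree_def)
  have fin: "finite (pverts T)"
    by (rule T.pair_finite_verts)
  have grow: "\<exists>S. S \<subseteq> pverts T \<and> card S = Suc n \<and> r \<in> S \<and> T.apath_connected S \<and> P (ind S)"
    if "Suc n \<le> card (pverts T)" for n
    using that
  proof (induction n)
    case 0
    have "ind {r} = single_vertex r"
      by (auto simp: ind_def single_vertex_def dest: T.no_loops')
    then show ?case
      using r single T.apath_connected_singleton by (intro exI[of _ "{r}"]) auto
  next
    case (Suc n)
    then obtain S where S: "S \<subseteq> pverts T" "card S = Suc n" "r \<in> S" "T.apath_connected S" "P (ind S)"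
      by auto
    have "S \<noteq> pverts T"
      using S Suc.prems by auto
    then obtain u v where uv: "u \<in> S" "v \<notin> S" "(u, v) \<in> parcs T"
      using T.connected_leaving_arc[OF conn S(1)] S(3) by blast
    have only: "w = u" if "w \<in> S" "(w, v) \<in> parcs T" for w
      using T.cycle_of_two_attachments[OF S(4) uv(1) that(1) _ uv(2,3) that(2)] acyclic by blast
    have "u \<notin> leaves T"
    proof (cases "u = r")
      case False
      obtain p where p: "T.apath u p r" "set (T.awalk_verts u p) \<subseteq> S"
        using S uv(1) unfolding T.apath_connected_def by blast
      then obtain e p' where "p = e # p'"
        using False by (cases p) (auto simp: T.apath_Nil_iff)
      with p have "(u, snd e) \<in> parcs T" "snd e \<in> S"
        by (auto simp: T.apath_Cons_iff dest: T.hd_in_awalk_verts)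
      with uv show ?thesis
        using T.not_leafI[of u v "snd e"] by auto
    qed (use r in simp)
    moreover have "v \<in> pverts T"
      using uv by (auto dest: T.in_arcsD2)
    moreover have "finite S"
      using S fin finite_subset by blast
    ultimately have "P (add_pendant (ind S) u v)"
      using S uv by (intro pendant) (auto simp: ind_def)
    moreover have "parcs T \<inter> insert v S \<times> insert v S = parcs T \<inter> S \<times> S \<union> {(u, v), (v, u)}"
    proof (intro equalityI subrelI)
      fix a b assume "(a, b) \<in> parcs T \<inter> insert v S \<times> insert v S"
      then show "(a, b) \<in> parcs T \<inter> S \<times> S \<union> {(u, v), (v, u)}"
        using only[of a] only[of b] T.arcs_symmetric[of a b] T.no_loops'[of a b] by blast
    next
      fix a b assume "(a, b) \<in> parcs T \<inter> S \<times> S \<union> {(u, v), (v, u)}"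
      then show "(a, b) \<in> parcs T \<inter> insert v S \<times> insert v S"
        using uv T.arcs_symmetric[OF uv(3)] by blast
    qed
    then have "add_pendant (ind S) u v = ind (insert v S)"
      by (simp add: add_pendant_def ind_def)
    ultimately show ?case
      using S uv \<open>finite S\<close> \<open>v \<in> pverts T\<close> T.apath_connected_insert[OF S(4) uv]
      by (intro exI[of _ "insert v S"]) auto
  qed
  have "card (pverts T) > 0"
    using r fin by (auto simp: card_gt_0_iff)
  then obtain S where "S \<subseteq> pverts T" "card S = card (pverts T)" "P (ind S)"
    using grow[of "card (pverts T) - 1"] by auto
  moreover from this have "S = pverts T"
    using fin by (simp add: card_subset_eq)
  moreover have "ind (pverts T) = T"
    by (auto simp: ind_def intro!: pair_pre_digraph.equality dest: T.in_arcsD1 T.in_arcsD2)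
  ultimately show ?thesis by simp
qed

section \<open>Random homomorphisms\<close>

text \<open>
  Gibbs' inequality against the uniform distribution. For \<open>\<nu> x > 0\<close> it comes from \<open>ln t \<le> t - 1\<close> at
  \<open>t = 1 / (\<nu> x * card A)\<close>: weighted by \<open>\<nu> x\<close>, the right-hand side is \<open>1 / card A - \<nu> x\<close>, and these
  differences sum to 0 over \<open>A\<close>.
\<close>

lemma entropy_le_ln_card:
  fixes \<nu> :: "'c \<Rightarrow> real"
  assumes fin: "finite A" and nonneg: "\<And>x. x \<in> A \<Longrightarrow> 0 \<le> \<nu> x" and total: "(\<Sum>x\<in>A. \<nu> x) = 1"
  shows "(\<Sum>x\<in>A. \<nu> x * ln (1 / \<nu> x)) \<le> ln (real (card A))"
proof -
  have "A \<noteq> {}"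
    using total by auto
  then have N: "real (card A) > 0"
    using fin by (simp add: card_gt_0_iff)
  have pt: "\<nu> x * ln (1 / \<nu> x) \<le> \<nu> x * ln (real (card A)) + (1 / real (card A) - \<nu> x)"
    if "x \<in> A" for x
  proof (cases "\<nu> x = 0")
    case False
    then have pos: "\<nu> x > 0"
      using nonneg[OF that] by simp
    have "ln (1 / (\<nu> x * real (card A))) \<le> 1 / (\<nu> x * real (card A)) - 1"
      using pos N by (intro ln_le_minus_one) auto
    then have "\<nu> x * ln (1 / (\<nu> x * real (card A))) \<le> \<nu> x * (1 / (\<nu> x * real (card A)) - 1)"
      using pos by (intro mult_left_mono) auto
    also have "\<dots> = 1 / real (card A) - \<nu> x"
      using pos N by (simp add: field_simps)
    finally show ?thesis
      using pos N by (simp add: ln_div ln_mult algebra_simps)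
  qed simp
  have "(\<Sum>x\<in>A. \<nu> x * ln (1 / \<nu> x))
      \<le> (\<Sum>x\<in>A. \<nu> x * ln (real (card A)) + (1 / real (card A) - \<nu> x))"
    using pt by (rule sum_mono)
  also have "\<dots> = ln (real (card A))"
    using N total by (simp add: sum.distrib sum_subtractf flip: sum_distrib_right)
  finally show ?thesis .
qed

text \<open>
  \<open>\<nu>\<close> is a probability distribution on the homomorphisms for which the image of every vertex outside \<open>L\<close>
  has law \<open>q\<close>. The marginals are expressed through expectations of test functions \<open>\<phi>\<close> instead of point
  probabilities: conditional entropies are such expectations.
\<close>

definition hom_distribution ::
  "'b set \<Rightarrow> 'b pair_pre_digraph \<Rightarrow> 'a pair_pre_digraph \<Rightarrow> ('a \<Rightarrow> real) \<Rightarrow> (('b \<Rightarrow> 'a) \<Rightarrow> real) \<Rightarrow> bool"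
  where
  "hom_distribution L H G q \<nu> \<longleftrightarrow>
     (\<forall>f \<in> homs H G. 0 \<le> \<nu> f) \<and> (\<Sum>f \<in> homs H G. \<nu> f) = 1 \<and>
     (\<forall>v \<in> pverts H - L. \<forall>\<phi>::'a \<Rightarrow> real.
        (\<Sum>f \<in> homs H G. \<nu> f * \<phi> (f v)) = (\<Sum>i \<in> pverts G. q i * \<phi> i))"

definition hom_entropy ::
  "'b pair_pre_digraph \<Rightarrow> 'a pair_pre_digraph \<Rightarrow> (('b \<Rightarrow> 'a) \<Rightarrow> real) \<Rightarrow> real" where
  "hom_entropy H G \<nu> = (\<Sum>f \<in> homs H G. \<nu> f * ln (1 / \<nu> f))"

lemma bij_betw_single_vertex_homs:
  "bij_betw (\<lambda>x. (\<lambda>_. undefined)(r := x)) (pverts G) (homs (single_vertex r) G)"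
  by (rule bij_betwI[where g = "\<lambda>f. f r"])
    (auto simp: homs_def single_vertex_def PiE_def extensional_def fun_eq_iff)

lemma single_vertex_distribution:
  fixes q :: "'a \<Rightarrow> real"
  assumes nonneg: "\<And>i. i \<in> pverts G \<Longrightarrow> 0 \<le> q i" and total: "(\<Sum>i \<in> pverts G. q i) = 1"
  shows "hom_distribution L (single_vertex r) G q (\<lambda>f. q (f r))"
    and "hom_entropy (single_vertex r) G (\<lambda>f. q (f r)) = entropy_Q G q"
proof -
  have sum: "(\<Sum>f \<in> homs (single_vertex r) G. \<psi> (f r)) = (\<Sum>i \<in> pverts G. \<psi> i)"
    for \<psi> :: "'a \<Rightarrow> real"
    by (subst sum.reindex_bij_betw[OF bij_betw_single_vertex_homs, symmetric]) simp
  show "hom_distribution L (single_vertex r) G q (\<lambda>f. q (f r))"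
    using nonneg total sum[of q] sum[of "\<lambda>i. q i * _ i"]
    by (auto simp: hom_distribution_def homs_def single_vertex_def)
  show "hom_entropy (single_vertex r) G (\<lambda>f. q (f r)) = entropy_Q G q"
    using sum[of "\<lambda>i. q i * ln (1 / q i)"] by (simp add: hom_entropy_def entropy_Q_def)
qed

context pair_graph
begin

lemma finite_homs: "finite (pverts H) \<Longrightarrow> finite (homs H G)"
  unfolding homs_def using pair_finite_verts
  by (auto intro: finite_subset[OF _ finite_PiE[of "pverts H" "\<lambda>_. pverts G"]])

text \<open>
  To extend a homomorphism to a pendant vertex is to choose a neighbour of the image of the vertex to
  which it is attached.
\<close>

lemma bij_betw_add_pendant_homs:
  assumes H: "parcs H \<subseteq> pverts H \<times> pverts H" and u: "u \<in> pverts H" and v: "v \<notin> pverts H"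
  shows "bij_betw (\<lambda>(f, y). f(v := y)) (SIGMA f : homs H G. nbrs G (f u))
    (homs (add_pendant H u v) G)"
proof (rule bij_betwI[where g = "\<lambda>g. (g(v := undefined), g v)"])
  have neq: "u \<noteq> v" "\<And>a b. (a, b) \<in> parcs H \<Longrightarrow> a \<noteq> v \<and> b \<noteq> v"
    using H u v by auto
  show "(\<lambda>(f, y). f(v := y)) \<in> (SIGMA f : homs H G. nbrs G (f u)) \<rightarrow> homs (add_pendant H u v) G"
    using neq by (auto simp: homs_def add_pendant_def nbrs_def PiE_def extensional_def
        intro: arcs_symmetric dest: in_arcsD2 split: if_splits)
  show "(\<lambda>g. (g(v := undefined), g v)) \<in> homs (add_pendant H u v) G \<rightarrow>
      (SIGMA f : homs H G. nbrs G (f u))"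
    using neq v by (auto simp: homs_def add_pendant_def nbrs_def PiE_def extensional_def Pi_iff)
  show "(\<lambda>g. (g(v := undefined), g v)) ((\<lambda>(f, y). f(v := y)) x) = x"
    if "x \<in> (SIGMA f : homs H G. nbrs G (f u))" for x
    using that v by (auto simp: homs_def fun_eq_iff PiE_def extensional_def)
qed auto

text \<open>
  The chain rule: draw the image of the new vertex \<open>v\<close> from the kernel \<open>k\<close> at the image of \<open>u\<close>.
  The increase in entropy is the expected entropy of \<open>k i\<close> for \<open>i\<close> the image of \<open>u\<close>, and that image
  has law \<open>q\<close> because \<open>u \<notin> L\<close>. The kernel has to preserve \<open>q\<close> only if \<open>v\<close> is one of the vertices whose
  law is recorded.
\<close>

lemma add_pendant_distribution:
  fixes k :: "'a \<Rightarrow> 'a \<Rightarrow> real" and q :: "'a \<Rightarrow> real" and H :: "'b pair_pre_digraph"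
  assumes fin: "finite (pverts H)" and H: "parcs H \<subseteq> pverts H \<times> pverts H"
    and u: "u \<in> pverts H" "u \<notin> L" and v: "v \<notin> pverts H"
    and \<nu>: "hom_distribution L H G q \<nu>"
    and k_nonneg: "\<And>i j. i \<in> pverts G \<Longrightarrow> j \<in> nbrs G i \<Longrightarrow> 0 \<le> k i j"
    and k_total: "\<And>i. i \<in> pverts G \<Longrightarrow> (\<Sum>j \<in> nbrs G i. k i j) = 1"
    and k_stationary: "\<And>\<phi>::'a \<Rightarrow> real. v \<notin> L \<Longrightarrow>
      (\<Sum>i \<in> pverts G. q i * (\<Sum>j \<in> nbrs G i. k i j * \<phi> j)) = (\<Sum>i \<in> pverts G. q i * \<phi> i)"
  obtains \<nu>' where "hom_distribution L (add_pendant H u v) G q \<nu>'"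
    and "hom_entropy (add_pendant H u v) G \<nu>' =
      hom_entropy H G \<nu> + (\<Sum>i \<in> pverts G. q i * (\<Sum>j \<in> nbrs G i. k i j * ln (1 / k i j)))"
proof -
  let ?H' = "add_pendant H u v"
  define \<nu>' where "\<nu>' g = \<nu> (g(v := undefined)) * k (g u) (g v)" for g
  have \<nu>_nonneg: "0 \<le> \<nu> f" if "f \<in> homs H G" for f
    using \<nu> that by (simp add: hom_distribution_def)
  have \<nu>_total: "(\<Sum>f \<in> homs H G. \<nu> f) = 1"
    using \<nu> by (simp add: hom_distribution_def)
  have \<nu>_marginal: "(\<Sum>f \<in> homs H G. \<nu> f * \<phi> (f w)) = (\<Sum>i \<in> pverts G. q i * \<phi> i)"
    if "w \<in> pverts H - L" for w and \<phi> :: "'a \<Rightarrow> real"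
    using \<nu> that by (simp add: hom_distribution_def)
  have fu: "f u \<in> pverts G" if "f \<in> homs H G" for f
    using that u by (auto simp: homs_def)
  have neq: "u \<noteq> v"
    using u v by auto
  have restrict: "f(v := undefined) = f" if "f \<in> homs H G" for f
    using that v by (auto simp: homs_def PiE_def extensional_def fun_eq_iff)
  have sum_homs: "(\<Sum>g \<in> homs ?H' G. F g) = (\<Sum>f \<in> homs H G. \<Sum>y \<in> nbrs G (f u). F (f(v := y)))"
    for F :: "('b \<Rightarrow> 'a) \<Rightarrow> real"
    using finite_homs[OF fin] finite_nbrs
    by (subst sum.reindex_bij_betw[OF bij_betw_add_pendant_homs[OF H u(1) v], symmetric])
      (simp add: sum.Sigma split_def)
  have \<nu>'_upd: "\<nu>' (f(v := y)) = \<nu> f * k (f u) y" if "f \<in> homs H G" for f y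
    using that neq by (simp add: \<nu>'_def restrict)
  \<comment> \<open>Forgetting the new image gives back \<open>\<nu>\<close>, because the kernel has total mass 1.\<close>
  have old: "(\<Sum>g \<in> homs ?H' G. \<nu>' g * F (g(v := undefined))) = (\<Sum>f \<in> homs H G. \<nu> f * F f)"
    for F :: "('b \<Rightarrow> 'a) \<Rightarrow> real"
    unfolding sum_homs
  proof (rule sum.cong[OF refl])
    fix f assume f: "f \<in> homs H G"
    have "(\<Sum>y \<in> nbrs G (f u). \<nu>' (f(v := y)) * F ((f(v := y))(v := undefined)))
        = (\<Sum>y \<in> nbrs G (f u). k (f u) y) * (\<nu> f * F f)"
      unfolding sum_distrib_right using f by (intro sum.cong) (simp_all add: \<nu>'_upd restrict)
    then show "(\<Sum>y \<in> nbrs G (f u). \<nu>' (f(v := y)) * F ((f(v := y))(v := undefined))) = \<nu> f * F f"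
      using f fu k_total by simp
  qed
  \<comment> \<open>The joint law of the images of \<open>u\<close> and \<open>v\<close>, tested against \<open>\<phi>\<close>.\<close>
  have new: "(\<Sum>g \<in> homs ?H' G. \<nu>' g * \<phi> (g u) (g v))
      = (\<Sum>i \<in> pverts G. q i * (\<Sum>j \<in> nbrs G i. k i j * \<phi> i j))" for \<phi> :: "'a \<Rightarrow> 'a \<Rightarrow> real"
  proof -
    have "(\<Sum>g \<in> homs ?H' G. \<nu>' g * \<phi> (g u) (g v))
        = (\<Sum>f \<in> homs H G. \<nu> f * (\<Sum>y \<in> nbrs G (f u). k (f u) y * \<phi> (f u) y))"
      unfolding sum_homs sum_distrib_left using neq
      by (intro sum.cong) (simp_all add: \<nu>'_upd mult.assoc)
    also have "\<dots> = (\<Sum>i \<in> pverts G. q i * (\<Sum>j \<in> nbrs G i. k i j * \<phi> i j))"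
      using u by (intro \<nu>_marginal[of u "\<lambda>i. \<Sum>j \<in> nbrs G i. k i j * \<phi> i j"]) simp
    finally show ?thesis .
  qed
  have homs': "g(v := undefined) \<in> homs H G \<and> g v \<in> nbrs G (g u)" if g: "g \<in> homs ?H' G" for g
  proof -
    obtain f y where "f \<in> homs H G" "y \<in> nbrs G (f u)" "g = f(v := y)"
      using bij_betw_imp_surj_on[OF bij_betw_add_pendant_homs[OF H u(1) v]] g by force
    then show ?thesis using neq by (simp add: restrict)
  qed
  have "0 \<le> \<nu>' g" if "g \<in> homs ?H' G" for g
    unfolding \<nu>'_def using homs'[OF that] neq fu[of "g(v := undefined)"]
    by (intro mult_nonneg_nonneg \<nu>_nonneg k_nonneg) auto
  moreover have "(\<Sum>g \<in> homs ?H' G. \<nu>' g) = 1"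
    using old[of "\<lambda>_. 1"] \<nu>_total by simp
  moreover have "(\<Sum>g \<in> homs ?H' G. \<nu>' g * \<phi> (g w)) = (\<Sum>i \<in> pverts G. q i * \<phi> i)"
    if w: "w \<in> pverts ?H' - L" for w and \<phi> :: "'a \<Rightarrow> real"
  proof (cases "w = v")
    case True
    then show ?thesis
      using new[of "\<lambda>_. \<phi>"] k_stationary w by simp
  next
    case False
    then have "w \<in> pverts H - L"
      using w by (simp add: add_pendant_def)
    then show ?thesis
      using old[of "\<lambda>f. \<phi> (f w)"] \<nu>_marginal False by simp
  qed
  ultimately have dist: "hom_distribution L ?H' G q \<nu>'"
    by (simp add: hom_distribution_def)
  \<comment> \<open>If \<open>\<nu>' g = 0\<close>, both sides vanish; otherwise both factors are nonzero and the logarithm splits.\<close>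
  have split: "\<nu>' g * ln (1 / \<nu>' g)
      = \<nu>' g * ln (1 / \<nu> (g(v := undefined))) + \<nu>' g * ln (1 / k (g u) (g v))" for g
    by (cases "\<nu>' g = 0") (auto simp: \<nu>'_def ln_mult ln_div algebra_simps)
  have "hom_entropy ?H' G \<nu>' =
      hom_entropy H G \<nu> + (\<Sum>i \<in> pverts G. q i * (\<Sum>j \<in> nbrs G i. k i j * ln (1 / k i j)))"
    unfolding hom_entropy_def
    by (subst split) (simp only: sum.distrib old new[of "\<lambda>i j. ln (1 / k i j)"]
        old[of "\<lambda>f. ln (1 / \<nu> f)"])
  with dist show thesis
    by (rule that)
qed

text \<open>
  Stationarity against test functions, by exchanging the two sums. The neighbours over which the
  stationarity equation sums are also the predecessors, since arcs are symmetric.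
\<close>

lemma stationary_distribution_functional:
  fixes \<phi> :: "'a \<Rightarrow> real"
  assumes "stationary_distribution G p q"
  shows "(\<Sum>i \<in> pverts G. q i * (\<Sum>j \<in> nbrs G i. p i j * \<phi> j)) = (\<Sum>i \<in> pverts G. q i * \<phi> i)"
proof -
  have nbrs: "nbrs G i = {j \<in> pverts G. (i, j) \<in> parcs G}" for i
    using nbrs_subset by (auto simp: nbrs_def)
  have nbrs': "nbrs G i = {j \<in> pverts G. (j, i) \<in> parcs G}" for i
    unfolding nbrs using arcs_symmetric by auto
  have "(\<Sum>i \<in> pverts G. q i * (\<Sum>j \<in> nbrs G i. p i j * \<phi> j))
      = (\<Sum>i \<in> pverts G. \<Sum>j | j \<in> pverts G \<and> (i, j) \<in> parcs G. q i * p i j * \<phi> j)"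
    by (simp add: nbrs sum_distrib_left mult.assoc)
  also have "\<dots> = (\<Sum>j \<in> pverts G. \<Sum>i | i \<in> pverts G \<and> (i, j) \<in> parcs G. q i * p i j * \<phi> j)"
    using pair_finite_verts by (intro sum.swap_restrict)
  also have "\<dots> = (\<Sum>j \<in> pverts G. (\<Sum>i \<in> nbrs G j. q i * p i j) * \<phi> j)"
    by (simp add: nbrs' sum_distrib_right)
  also have "\<dots> = (\<Sum>j \<in> pverts G. q j * \<phi> j)"
    using assms by (simp add: stationary_distribution_def)
  finally show ?thesis .
qed

end

section \<open>The lower bound\<close>

theorem theorem3p1:
  fixes G :: "'a pair_pre_digraph" and T :: "'b pair_pre_digraph"
    and p :: "'a \<Rightarrow> 'a \<Rightarrow> real" and q :: "'a \<Rightarrow> real" and m l :: nat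
  assumes "pair_graph G"
    and "markov_chain_on G p"
    and "stationary_distribution G p q"
    and "undirected_tree T"
    and "card (pverts T) = m"
    and "card (leaves T) = l"
    and "m \<ge> 3"
  shows "real (hom_count T G) \<ge>
    exp (entropy_Q G q + real l * entropy_D_given_Q G q
         + (real m - 1 - real l) * entropy_P_given_Q G p q)"
proof -
  interpret G: pair_graph G by fact
  interpret T: pair_graph T
    using assms(4) by (simp add: undirected_tree_def)
  \<comment> \<open>A separate name keeps the induction below from replacing \<open>leaves T\<close> by the leaves of the subtree.\<close>
  define L where "L = leaves T"
  define uniform :: "'a \<Rightarrow> 'a \<Rightarrow> real" where "uniform i j = 1 / real (card (nbrs G i))" for i j
  have p_nonneg: "0 \<le> p i j" if "i \<in> pverts G" "j \<in> nbrs G i" for i j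
    using assms(2) that G.nbrs_subset by (auto simp: markov_chain_on_def)
  have p_total: "(\<Sum>j \<in> nbrs G i. p i j) = 1" if "i \<in> pverts G" for i
    using assms(2) that by (simp add: markov_chain_on_def)
  have no_isolated: "nbrs G i \<noteq> {}" if "i \<in> pverts G" for i
    using p_total[OF that] by auto
  have q: "\<And>i. i \<in> pverts G \<Longrightarrow> 0 \<le> q i" "(\<Sum>i \<in> pverts G. q i) = 1"
    using assms(3) by (auto simp: stationary_distribution_def)
  note p_stationary = G.stationary_distribution_functional[OF assms(3)]
  have uniform_total: "(\<Sum>j \<in> nbrs G i. uniform i j) = 1" if "i \<in> pverts G" for i
    using no_isolated[OF that] G.finite_nbrs[of i] by (simp add: uniform_def)
  have entropy_D: "entropy_D_given_Q G q
      = (\<Sum>i \<in> pverts G. q i * (\<Sum>j \<in> nbrs G i. uniform i j * ln (1 / uniform i j)))"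
    unfolding entropy_D_given_Q_def using no_isolated G.finite_nbrs
    by (intro sum.cong) (simp_all add: uniform_def out_degree_eq_card_nbrs)
  obtain r where r: "r \<in> pverts T" "r \<notin> leaves T"
    using T.connected_nonleaf_exists assms by (auto simp: undirected_tree_def)
  have "\<exists>\<nu>. hom_distribution L T G q \<nu> \<and> hom_entropy T G \<nu> =
      entropy_Q G q + real (card (pverts T \<inter> L)) * entropy_D_given_Q G q
      + (real (card (pverts T - L)) - 1) * entropy_P_given_Q G p q"
    using assms(4) r
  proof (induction rule: undirected_tree_induct)
    case single
    then show ?case
      using single_vertex_distribution(1)[OF q, of L r]
        single_vertex_distribution(2)[OF q, of r] r(2)[folded L_def]
      by (intro exI[of _ "\<lambda>f. q (f r)"]) (auto simp: single_vertex_def insert_Diff_if)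
  next
    case (pendant H u v)
    then obtain \<nu> where \<nu>: "hom_distribution L H G q \<nu>"
      and ent: "hom_entropy H G \<nu> =
        entropy_Q G q + real (card (pverts H \<inter> L)) * entropy_D_given_Q G q
        + (real (card (pverts H - L)) - 1) * entropy_P_given_Q G p q"
      by auto
    note step = G.add_pendant_distribution[OF pendant(1,2,5) pendant(6)[folded L_def] pendant(8) \<nu>]
    show ?case
    proof (cases "v \<in> L")
      case True
      have "pverts (add_pendant H u v) \<inter> L = insert v (pverts H \<inter> L)"
        "pverts (add_pendant H u v) - L = pverts H - L"
        using True by (auto simp: add_pendant_def)
      then have "card (pverts (add_pendant H u v) \<inter> L) = Suc (card (pverts H \<inter> L))"
        "card (pverts (add_pendant H u v) - L) = card (pverts H - L)"
        using pendant by simp_all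
      moreover obtain \<nu>' where "hom_distribution L (add_pendant H u v) G q \<nu>'"
        "hom_entropy (add_pendant H u v) G \<nu>' = hom_entropy H G \<nu> + entropy_D_given_Q G q"
        by (rule step[of uniform, folded entropy_D])
          (use True uniform_total in \<open>auto simp: uniform_def\<close>)
      ultimately show ?thesis
        using ent by (intro exI[of _ \<nu>']) (simp add: algebra_simps)
    next
      case False
      have "pverts (add_pendant H u v) \<inter> L = pverts H \<inter> L"
        "pverts (add_pendant H u v) - L = insert v (pverts H - L)"
        using False by (auto simp: add_pendant_def)
      then have "card (pverts (add_pendant H u v) \<inter> L) = card (pverts H \<inter> L)"
        "card (pverts (add_pendant H u v) - L) = Suc (card (pverts H - L))"
        using pendant by simp_all
      moreover obtain \<nu>' where "hom_distribution L (add_pendant H u v) G q \<nu>'"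
        "hom_entropy (add_pendant H u v) G \<nu>' = hom_entropy H G \<nu> + entropy_P_given_Q G p q"
        by (rule step[of p, folded entropy_P_given_Q_def])
          (simp_all add: p_nonneg p_total p_stationary)
      ultimately show ?thesis
        using ent by (intro exI[of _ \<nu>']) (simp add: algebra_simps)
    qed
  qed
  then obtain \<nu> where \<nu>: "hom_distribution L T G q \<nu>" and ent: "hom_entropy T G \<nu> =
      entropy_Q G q + real (card (pverts T \<inter> L)) * entropy_D_given_Q G q
      + (real (card (pverts T - L)) - 1) * entropy_P_given_Q G p q"
    by auto
  have L_subset: "L \<subseteq> pverts T"
    by (auto simp: L_def leaves_def)
  have fin: "finite (pverts T)"
    by (rule T.pair_finite_verts)
  have "pverts T \<inter> L = L"
    using L_subset by auto
  moreover have "real (card (pverts T - L)) - 1 = real m - 1 - real l"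
    using assms(5,6) fin finite_subset[OF L_subset fin] card_mono[OF fin L_subset] L_subset
    by (simp add: L_def card_Diff_subset of_nat_diff)
  ultimately have "entropy_Q G q + real l * entropy_D_given_Q G q
      + (real m - 1 - real l) * entropy_P_given_Q G p q = hom_entropy T G \<nu>"
    using ent assms(6) by (simp add: L_def)
  also have "\<dots> \<le> ln (real (hom_count T G))"
    unfolding hom_entropy_def hom_count_def using \<nu> G.finite_homs[OF fin]
    by (intro entropy_le_ln_card) (auto simp: hom_distribution_def)
  finally have "entropy_Q G q + real l * entropy_D_given_Q G q
      + (real m - 1 - real l) * entropy_P_given_Q G p q \<le> ln (real (hom_count T G))" .
  moreover have "hom_count T G > 0"
    using \<nu> G.finite_homs[OF fin] by (auto simp: hom_distribution_def hom_count_def card_gt_0_iff)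
  ultimately show ?thesis
    by (simp add: ln_ge_iff)
qed

end
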